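(* Suppose that for each site $j\in V$ there is a block $\Theta_j=\{j\}$ and that $\Theta=\{\Theta_j\}_{j=1,\dots,n}$. Suppose also that for each $j$ and each pair $(x,y)\in S_i$ of configurations, $\Psi_j(x,y)$ is a coupling of $P^{[j]}(x)$ and $P^{[j]}(y)$ in which, for each $c\in C$, $$\Pr_{(x',y')\in\Psi_j(x,y)}(x'_j=y'_j=c)=\min\bigl(\Pr_{\mu_j(x)}(c),\Pr_{\mu_j(y)}(c)\bigr),$$ where $\Pr_{\mu_j(x)}(c)$ is the probability of drawing $c$ from $\mu_j(x)$. Then $\rho_{i,j}^j=\hat\rho_{i,j}$.
   Context: $C=\{1,\dots,q\}$ is a finite set of spins, $V=\{1,\dots,n\}$ the set of sites of a finite graph, and $\Omega^+$ the set of all configurations (maps $V\to C$). $\pi$ is a probability distribution on $\Omega^+$. $S_i$ is the set of pairs $(x,y)\in\Omega^+\times\Omega^+$ with $x_l=y_l$ for all $l\neq i$. With the block $\Theta_j$ is associated a transition matrix $P^{[j]}$ on $\Omega^+$ such that $P^{[j]}(x,y)>0$ implies $x=y$ on $V\setminus\Theta_j$, and $\pi$ is invariant with respect to $P^{[j]}$; $P^{[j]}(x)$ is the distribution obtained by applying $P^{[j]}$ once to $x$. $\mu_j(x)$ is the distribution on spins at site $j$ induced by $P^{[j]}(x)$. $\rho_{i,j}^j=\max_{(x,y)\in S_i}\Pr_{(x',y')\in\Psi_j(x,y)}(x'_j\ne y'_j)$, and the single-site influence is $\hat\rho_{i,j}=\max_{(x,y)\in S_i}\mathrm{d}_{\mathrm{TV}}(\mu_j(x),\mu_j(y))$,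 where $\mathrm{d}_{\mathrm{TV}}(\theta_1,\theta_2)=\frac12\sum_c|\theta_1(c)-\theta_2(c)|$. *)

theory Defs
  imports "HOL-Probability.Probability"
begin

type_synonym config = "nat \<Rightarrow> nat"

definition sites :: "nat \<Rightarrow> nat set"
  where "sites n = {1..n}"

definition spins :: "nat \<Rightarrow> nat set"
  where "spins q = {1..q}"

text \<open>Configurations are extensional, so that equality of configurations is equality on the sites.\<close>
definition configs :: "nat \<Rightarrow> nat \<Rightarrow> config set"
  where "configs n q = sites n \<rightarrow>\<^sub>E spins q"

definition diff_pairs :: "nat \<Rightarrow> nat \<Rightarrow> nat \<Rightarrow> (config \<times> config) set"
  where "diff_pairs n q i =
    {(x, y) \<in> configs n q \<times> configs n q. \<forall>l\<in>sites n. l \<noteq> i \<longrightarrow> x l = y l}"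

text \<open>A transition matrix is given by its rows: its \<open>(x, y)\<close> entry is \<open>pmf (P x) y\<close>, and \<open>P x\<close>
  is the distribution after one step from \<open>x\<close>. The rows of \<open>P\<close> outside \<open>configs n q\<close>
  are irrelevant.\<close>
definition block_update ::
    "nat \<Rightarrow> nat \<Rightarrow> config pmf \<Rightarrow> nat set \<Rightarrow> (config \<Rightarrow> config pmf) \<Rightarrow> bool"
  where "block_update n q \<pi> B P \<longleftrightarrow>
    (\<forall>x\<in>configs n q. set_pmf (P x) \<subseteq> configs n q) \<and>
    (\<forall>x\<in>configs n q. \<forall>y\<in>configs n q. pmf (P x) y > 0 \<longrightarrow> (\<forall>l\<in>sites n - B. x l = y l)) \<and>
    bind_pmf \<pi> P = \<pi>"

definition is_coupling :: "('a \<times> 'b) pmf \<Rightarrow> 'a pmf \<Rightarrow> 'b pmf \<Rightarrow> bool"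
  where "is_coupling \<psi> \<theta>\<^sub>1 \<theta>\<^sub>2 \<longleftrightarrow> map_pmf fst \<psi> = \<theta>\<^sub>1 \<and> map_pmf snd \<psi> = \<theta>\<^sub>2"

definition site_dist :: "(nat \<Rightarrow> config \<Rightarrow> config pmf) \<Rightarrow> nat \<Rightarrow> config \<Rightarrow> nat pmf"
  where "site_dist P j x = map_pmf (\<lambda>x'. x' j) (P j x)"

definition tv_dist :: "nat \<Rightarrow> nat pmf \<Rightarrow> nat pmf \<Rightarrow> real"
  where "tv_dist q \<theta>\<^sub>1 \<theta>\<^sub>2 = 1 / 2 * (\<Sum>c\<in>spins q. \<bar>pmf \<theta>\<^sub>1 c - pmf \<theta>\<^sub>2 c\<bar>)"

text \<open>The influence of site \<open>i\<close> on site \<open>j\<close> under the update of block \<open>k\<close>,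
  with respect to the couplings \<open>\<Psi> k x y\<close>.\<close>
definition influence ::
    "nat \<Rightarrow> nat \<Rightarrow> (nat \<Rightarrow> config \<Rightarrow> config \<Rightarrow> (config \<times> config) pmf) \<Rightarrow> nat \<Rightarrow> nat \<Rightarrow> nat \<Rightarrow> real"
  where "influence n q \<Psi> k i j =
    Max ((\<lambda>(x, y). measure_pmf.prob (\<Psi> k x y) {(x', y'). x' j \<noteq> y' j}) ` diff_pairs n q i)"

definition site_influence ::
    "nat \<Rightarrow> nat \<Rightarrow> (nat \<Rightarrow> config \<Rightarrow> config pmf) \<Rightarrow> nat \<Rightarrow> nat \<Rightarrow> real"
  where "site_influence n q P i j =
    Max ((\<lambda>(x, y). tv_dist q (site_dist P j x) (site_dist P j y)) ` diff_pairs n q i)"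

lemma finite_diff_pairs: "finite (diff_pairs n q i)"
proof -
  have "finite (configs n q)"
    by (simp add: configs_def sites_def spins_def finite_PiE)
  moreover have "diff_pairs n q i \<subseteq> configs n q \<times> configs n q"
    by (auto simp: diff_pairs_def)
  ultimately show ?thesis
    using finite_subset by blast
qed

text \<open>A distribution \<open>\<pi>\<close> on the configurations exists only if there is a configuration at all, so
  the maxima above range over nonempty sets.\<close>
lemma diff_pairs_nonempty:
  assumes "set_pmf \<pi> \<subseteq> configs n q"
  shows "diff_pairs n q i \<noteq> {}"
proof -
  obtain x where "x \<in> set_pmf \<pi>"
    using set_pmf_not_empty by fastforce
  with assms have "(x, x) \<in> diff_pairs n q i"
    by (auto simp: diff_pairs_def)
  then show ?thesis
    by blast
qed

end

theory Submission
  imports Defs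
begin

text \<open>The prescribed couplings are the optimal ones at site \<open>j\<close>: the two spins
  agree on the value \<open>c\<close> with the largest probability that the marginals allow, the
  minimum of their masses at \<open>c\<close>. Summing over all spins, disagreement has probability
  one minus the total overlap of the two spin distributions
  (\<open>prob_neq_eq_one_minus_sum\<close>), and this is exactly their total variation distance
  (\<open>tv_dist_eq_one_minus_sum_min\<close>). So the quantities under the two maxima coincide
  pair by pair, and the maxima are equal.\<close>

lemma prob_neq_eq_one_minus_sum:
  fixes f g :: "'a \<Rightarrow> 'b"
  assumes "finite S" "\<And>z. z \<in> set_pmf \<psi> \<Longrightarrow> f z \<in> S"
  shows "measure_pmf.prob \<psi> {z. f z \<noteq> g z} =
    1 - (\<Sum>c\<in>S. measure_pmf.prob \<psi> {z. f z = c \<and> g z = c})"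
proof -
  have "measure_pmf.prob \<psi> {z. f z \<noteq> g z} = 1 - measure_pmf.prob \<psi> {z. f z = g z}"
    using measure_pmf.prob_compl[of "{z. f z = g z}" \<psi>] by (simp add: Compl_eq_Diff_UNIV[symmetric] Collect_neg_eq[symmetric])
  \<comment> \<open>The two events need only agree almost surely, since \<open>f\<close> is known to
    take values in \<open>S\<close> only on the support of \<psi>.\<close>
  also have "measure_pmf.prob \<psi> {z. f z = g z} =
      measure_pmf.prob \<psi> (\<Union>c\<in>S. {z. f z = c \<and> g z = c})"
    using assms(2) by (intro measure_pmf.finite_measure_eq_AE) (auto simp: AE_measure_pmf_iff)
  also have "\<dots> = (\<Sum>c\<in>S. measure_pmf.prob \<psi> {z. f z = c \<and> g z = c})"
    using assms(1)
    by (intro measure_pmf.finite_measure_finite_Union) (auto simp: disjoint_family_on_def)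
  finally show ?thesis .
qed

text \<open>This rests on the identity |a - b| = a + b - 2 min(a, b). Support in
  \<open>spins q\<close> makes each distribution sum to 1 there, so the halved sum is (2 - 2 *
  overlap) / 2.\<close>

lemma tv_dist_eq_one_minus_sum_min:
  assumes "set_pmf \<theta>\<^sub>1 \<subseteq> spins q" "set_pmf \<theta>\<^sub>2 \<subseteq> spins q"
  shows "tv_dist q \<theta>\<^sub>1 \<theta>\<^sub>2 = 1 - (\<Sum>c\<in>spins q. min (pmf \<theta>\<^sub>1 c) (pmf \<theta>\<^sub>2 c))"
proof -
  have "(\<Sum>c\<in>spins q. \<bar>pmf \<theta>\<^sub>1 c - pmf \<theta>\<^sub>2 c\<bar>) =
      (\<Sum>c\<in>spins q. pmf \<theta>\<^sub>1 c + pmf \<theta>\<^sub>2 c - 2 * min (pmf \<theta>\<^sub>1 c) (pmf \<theta>\<^sub>2 c))"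
    by (intro sum.cong) auto
  also have "\<dots> = 2 - 2 * (\<Sum>c\<in>spins q. min (pmf \<theta>\<^sub>1 c) (pmf \<theta>\<^sub>2 c))"
    using sum_pmf_eq_1[OF _ assms(1)] sum_pmf_eq_1[OF _ assms(2)]
    by (simp add: sum.distrib sum_subtractf sum_distrib_left spins_def)
  finally show ?thesis
    by (simp add: tv_dist_def)
qed

theorem lemma21:
  fixes n q :: nat
    and \<pi> :: "config pmf"
    and \<Theta> :: "nat \<Rightarrow> nat set"
    and P :: "nat \<Rightarrow> config \<Rightarrow> config pmf"
    and \<Psi> :: "nat \<Rightarrow> config \<Rightarrow> config \<Rightarrow> (config \<times> config) pmf"
  assumes "set_pmf \<pi> \<subseteq> configs n q"
    and "\<And>j. j \<in> sites n \<Longrightarrow> \<Theta> j = {j}"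
    and "\<And>j. j \<in> sites n \<Longrightarrow> block_update n q \<pi> (\<Theta> j) (P j)"
    and "\<And>i j x y. i \<in> sites n \<Longrightarrow> j \<in> sites n \<Longrightarrow> (x, y) \<in> diff_pairs n q i \<Longrightarrow>
      is_coupling (\<Psi> j x y) (P j x) (P j y)"
    and "\<And>i j x y c. i \<in> sites n \<Longrightarrow> j \<in> sites n \<Longrightarrow> (x, y) \<in> diff_pairs n q i \<Longrightarrow> c \<in> spins q \<Longrightarrow>
      measure_pmf.prob (\<Psi> j x y) {(x', y'). x' j = c \<and> y' j = c} =
        min (pmf (site_dist P j x) c) (pmf (site_dist P j y) c)"
  shows "\<forall>i\<in>sites n. \<forall>j\<in>sites n. influence n q \<Psi> j i j = site_influence n q P i j"
proof (intro ballI)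
  fix i j
  assume ij: "i \<in> sites n" "j \<in> sites n"
  have "measure_pmf.prob (\<Psi> j x y) {(x', y'). x' j \<noteq> y' j} =
      tv_dist q (site_dist P j x) (site_dist P j y)"
    if xy: "(x, y) \<in> diff_pairs n q i" for x y
  proof -
    have "x \<in> configs n q" "y \<in> configs n q"
      using xy by (auto simp: diff_pairs_def)
    then have sub: "set_pmf (P j x) \<subseteq> configs n q" "set_pmf (P j y) \<subseteq> configs n q"
      using assms(3)[OF ij(2)] by (auto simp: block_update_def)
    have spin: "z j \<in> spins q" if "z \<in> configs n q" for z
      using that ij(2) by (auto simp: configs_def)
    have "map_pmf fst (\<Psi> j x y) = P j x"
      using assms(4)[OF ij xy] by (simp add: is_coupling_def)
    \<comment> \<open>The first marginal of the coupling confines x' to configurations, so its value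
      at \<open>j\<close> is almost surely a spin; a common value of x' and y' at \<open>j\<close>
      is then also a spin.\<close>
    then have "fst ` set_pmf (\<Psi> j x y) \<subseteq> configs n q"
      using sub(1) by (metis set_map_pmf)
    then have "measure_pmf.prob (\<Psi> j x y) {z. fst z j \<noteq> snd z j} =
        1 - (\<Sum>c\<in>spins q. measure_pmf.prob (\<Psi> j x y) {z. fst z j = c \<and> snd z j = c})"
      using spin by (intro prob_neq_eq_one_minus_sum) (auto simp: spins_def)
    also have "\<dots> = 1 - (\<Sum>c\<in>spins q. min (pmf (site_dist P j x) c) (pmf (site_dist P j y) c))"
      using assms(5)[OF ij xy] by (simp add: case_prod_unfold)
    also have "\<dots> = tv_dist q (site_dist P j x) (site_dist P j y)"
      using sub spin by (intro tv_dist_eq_one_minus_sum_min[symmetric]) (auto simp: site_dist_def)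
    finally show ?thesis
      by (simp add: case_prod_unfold)
  qed
  \<comment> \<open>Both maxima range over the same pairs, so pointwise equality makes the two image
    sets identical.\<close>
  then show "influence n q \<Psi> j i j = site_influence n q P i j"
    unfolding influence_def site_influence_def by (intro arg_cong[where f = Max] image_cong) auto
qed

end
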